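(* Let $W_3(n)$ be a uniformly random word of length $n$ over a $3$-letter alphabet. Then, with probability $1-e^{-\Omega(n/\log n)}$ (as $n\to\infty$), $$t(W_3(n))\ge 0.411\, n.$$
   Context: A word $w=w_1w_2\cdots w_n$ over a finite alphabet $A$ contains twins of length $t$ if there exist disjoint sets of indices $\{i_1<\cdots<i_t\}$ and $\{j_1<\cdots<j_t\}$ in $\{1,\dots,n\}$ with $w_{i_1}\cdots w_{i_t}=w_{j_1}\cdots w_{j_t}$. $t(w)$ denotes the maximum length of twins in $w$. $W_k(n)$ denotes a word chosen uniformly at random among all $k^n$ words of length $n$ over a $k$-letter alphabet (equivalently, $n$ independent uniform letters). *)

theory Defs
  imports "HOL-Probability.Probability"
begin

text \<open>Words are lists; positions are counted from 0. The subword of \<open>w\<close> at the set of positions \<open>I\<close>,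
  read in increasing order, is the library's \<^term>\<open>nths w I\<close>.\<close>

definition has_twins :: "'a list \<Rightarrow> nat \<Rightarrow> bool" where
  "has_twins w t \<longleftrightarrow> (\<exists>I J. I \<subseteq> {..<length w} \<and> J \<subseteq> {..<length w} \<and> I \<inter> J = {} \<and>
     card I = t \<and> card J = t \<and> nths w I = nths w J)"

definition max_twins :: "'a list \<Rightarrow> nat" where
  "max_twins w = Max {t. has_twins w t}"

definition random_word :: "'a set \<Rightarrow> nat \<Rightarrow> 'a list pmf" where
  "random_word A n = pmf_of_set {w. set w \<subseteq> A \<and> length w = n}"

text \<open>The maximum in \<^const>\<open>max_twins\<close> is over a finite nonempty set.\<close>

lemma has_twins_le_length: "has_twins w t \<Longrightarrow> t \<le> length w"
  unfolding has_twins_def using card_mono[of "{..<length w}"] by fastforce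

lemma finite_has_twins: "finite {t. has_twins w t}"
  by (rule finite_subset[of _ "{..length w}"]) (auto dest: has_twins_le_length)

lemma has_twins_0: "has_twins w 0"
  unfolding has_twins_def by (intro exI[of _ "{}"]) auto

end

theory Submission
  imports Defs "HOL-Real_Asymp.Real_Asymp"
begin

text \<open>Read the word from left to right and build twins letter by letter: one twin runs ahead of the other, and
  the letters by which it is ahead form a queue. Each new letter is dropped, appended to the queue, or,
  if it is the head of the queue, removed from it, which lengthens the twins by one. Which choices are
  right is only revealed later, so we keep a set of candidate queues of length at most 2, each with its
  score. Up to renaming letters eight such sets suffice, and a random ternary word drives a Markov
  chain on them with mean gain \<open>219/532 > 0.411\<close> per letter. Instead of the mean we bound the
  exponential moment of the gain by a weight on the eight states that contracts in one step, and the
  tail estimate (even with \<open>n\<close> in place of \<open>n / ln n\<close>) is Markov's inequality.\<close>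

section \<open>Twins encoded by a queue\<close>

text \<open>Twins of length \<open>t\<close> can be completed within \<open>w\<close> when \<open>q\<close> is the current queue: the twin at
  \<open>I\<close> is the one ahead, and the queue is used up at the end.\<close>

definition echo :: "'a list \<Rightarrow> 'a list \<Rightarrow> nat \<Rightarrow> bool" where
  "echo q w t \<longleftrightarrow> (\<exists>I J. I \<subseteq> {..<length w} \<and> J \<subseteq> {..<length w} \<and> I \<inter> J = {} \<and>
     card J = t \<and> nths w J = q @ nths w I)"

lemma echo_Nil: "echo [] [] 0"
  by (auto simp: echo_def)

lemma nths_Cons_Suc: "nths (x # w) (Suc ` I) = nths w I"
  by (simp add: nths_Cons inj_image_mem_iff)

lemma nths_Cons_insert_Suc: "nths (x # w) (insert 0 (Suc ` I)) = x # nths w I"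
  by (simp add: nths_Cons inj_image_mem_iff)

text \<open>The new letter joins neither twin here; in \<open>echo_push\<close> it joins the twin
  ahead and the end of the queue, in \<open>echo_match\<close> the twin behind.\<close>

lemma echo_skip:
  assumes "echo q w t" shows "echo q (x # w) t"
proof -
  obtain I J where "I \<subseteq> {..<length w}" "J \<subseteq> {..<length w}" "I \<inter> J = {}" "card J = t"
    "nths w J = q @ nths w I" using assms by (auto simp: echo_def)
  then show ?thesis unfolding echo_def
    by (intro exI[of _ "Suc ` I"] exI[of _ "Suc ` J"]) (auto simp: nths_Cons_Suc card_image)
qed

lemma echo_push:
  assumes "echo (q @ [x]) w t" shows "echo q (x # w) t"
proof -
  obtain I J where "I \<subseteq> {..<length w}" "J \<subseteq> {..<length w}" "I \<inter> J = {}" "card J = t"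
    "nths w J = (q @ [x]) @ nths w I" using assms by (auto simp: echo_def)
  then show ?thesis unfolding echo_def
    by (intro exI[of _ "insert 0 (Suc ` I)"] exI[of _ "Suc ` J"])
      (auto simp: nths_Cons_Suc nths_Cons_insert_Suc card_image)
qed

lemma echo_match:
  assumes "echo q w t" shows "echo (x # q) (x # w) (Suc t)"
proof -
  obtain I J where *: "I \<subseteq> {..<length w}" "J \<subseteq> {..<length w}" "I \<inter> J = {}" "card J = t"
    "nths w J = q @ nths w I" using assms by (auto simp: echo_def)
  have "finite J" using * finite_subset by blast
  then have "card (insert 0 (Suc ` J)) = Suc t" using * by (simp add: card_image)
  then show ?thesis using * unfolding echo_def
    by (intro exI[of _ "Suc ` I"] exI[of _ "insert 0 (Suc ` J)"])
      (auto simp: nths_Cons_Suc nths_Cons_insert_Suc)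
qed

lemma card_eq_length_nths: "I \<subseteq> {..<length w} \<Longrightarrow> card I = length (nths w I)"
  unfolding length_nths by (rule arg_cong[where f = card]) auto

lemma echo_imp_has_twins: "echo [] w t \<Longrightarrow> has_twins w t"
  unfolding echo_def has_twins_def by (metis append_Nil card_eq_length_nths)

section \<open>Automaton on sets of candidate queues\<close>

datatype 'a state = Empty | One 'a | Fork 'a 'a | Chain 'a 'a | Late 'a 'a
  | Late2 'a 'a 'a | Join 'a 'a 'a | Star 'a 'a 'a

text \<open>A state stands for its set of candidate queues; the number attached to a queue is the deficit of
  its score against that of the empty queue.\<close>

fun cands :: "'a state \<Rightarrow> ('a list \<times> nat) set" where
  "cands Empty = {([], 0)}"
| "cands (One a) = {([], 0), ([a], 0)}"
| "cands (Fork a b) = {([], 0), ([a], 0), ([b], 0)}"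
| "cands (Chain a b) = {([], 0), ([a], 0), ([b], 0), ([a, b], 0)}"
| "cands (Late a b) = {([], 0), ([a, b], 1)}"
| "cands (Late2 a b c) = {([], 0), ([a, c], 1), ([b, c], 1)}"
| "cands (Join a b c) = {([], 0), ([a], 0), ([b], 0), ([c], 0), ([a, c], 0), ([b, c], 0)}"
| "cands (Star a b c) = {([], 0), ([a], 0), ([b], 0), ([c], 0),
    ([a, b], 0), ([a, c], 0), ([b, c], 0)}"

text \<open>The first component is the increase of the score of the empty queue. In \<open>Late2\<close>, \<open>Join\<close> and
  \<open>Star\<close> the letters are the whole alphabet, so the last branch covers all remaining letters.\<close>

fun step :: "'a state \<Rightarrow> 'a \<Rightarrow> nat \<times> 'a state" where
  "step Empty x = (0, One x)"
| "step (One a) x = (if x = a then (1, Empty) else (0, Chain a x))"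
| "step (Fork a b) x =
    (if x = a then (1, Late b a) else if x = b then (1, Late a b) else (0, Join a b x))"
| "step (Chain a b) x =
    (if x = a then (1, One b) else if x = b then (1, Late a b) else (0, Star a b x))"
| "step (Late a b) x = (0, if x = a then Fork a b else One x)"
| "step (Late2 a b c) x = (0, if x = c then One c else Fork x c)"
| "step (Join a b c) x = (1, if x = c then Late2 a b c else One c)"
| "step (Star a b c) x = (1, if x = a then Fork b c else if x = b then One c else Late2 a b c)"

fun gain :: "'a state \<Rightarrow> 'a list \<Rightarrow> nat" where
  "gain s [] = 0"
| "gain s (x # w) = fst (step s x) + gain (snd (step s x)) w"

fun proper :: "'a set \<Rightarrow> 'a state \<Rightarrow> bool" where
  "proper A Empty \<longleftrightarrow> True"
| "proper A (One a) \<longleftrightarrow> a \<in> A"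
| "proper A (Fork a b) \<longleftrightarrow> a \<in> A \<and> b \<in> A \<and> a \<noteq> b"
| "proper A (Chain a b) \<longleftrightarrow> a \<in> A \<and> b \<in> A \<and> a \<noteq> b"
| "proper A (Late a b) \<longleftrightarrow> a \<in> A \<and> b \<in> A \<and> a \<noteq> b"
| "proper A (Late2 a b c) \<longleftrightarrow> A = {a, b, c} \<and> distinct [a, b, c]"
| "proper A (Join a b c) \<longleftrightarrow> A = {a, b, c} \<and> distinct [a, b, c]"
| "proper A (Star a b c) \<longleftrightarrow> A = {a, b, c} \<and> distinct [a, b, c]"

lemma card_3_eqI:
  assumes "card A = 3" "a \<in> A" "b \<in> A" "c \<in> A" "distinct [a, b, c]"
  shows "A = {a, b, c}"
  using assms by (intro card_seteq[symmetric]) (auto intro: card_ge_0_finite)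

lemma proper_step:
  assumes "card A = 3" "x \<in> A" "proper A s"
  shows "proper A (snd (step s x))"
  using assms by (cases s) (auto simp: card_3_eqI)

text \<open>Each new candidate comes from an old one by dropping, appending or matching
  \<open>x\<close>. With gain 1, a candidate reached without a match falls to deficit 1; a match
  from deficit 1 with gain 0 brings it back to 0.\<close>

lemma ex_cands_echo_Cons:
  assumes "proper A s" "x \<in> A"
    and q': "(q', d') \<in> cands (snd (step s x))" "echo q' w (m + d')"
  shows "\<exists>(q, d) \<in> cands s. echo q (x # w) (fst (step s x) + m + d)"
proof -
  have skip: "echo q' (x # w) (m + d')" and match: "echo (x # q') (x # w) (Suc (m + d'))"
    using q'(2) by (rule echo_skip, rule echo_match)
  have push: "echo (butlast q') (x # w) (m + d')" if "q' \<noteq> []" "last q' = x"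
    using q'(2) that by (intro echo_push) (metis append_butlast_last_id)
  show ?thesis
  proof (cases s)
    case Empty
    then show ?thesis using q'(1) skip push by auto
  next
    case (One a)
    then show ?thesis using q'(1) skip push match by (auto split: if_splits)
  next
    case (Fork a b)
    then show ?thesis using q'(1) skip push match by (auto split: if_splits)
  next
    case (Chain a b)
    then show ?thesis using q'(1) skip push match by (auto split: if_splits)
  next
    case (Late a b)
    then show ?thesis using q'(1) skip push match by (auto split: if_splits)
  next
    case (Late2 a b c)
    then show ?thesis using assms(1,2) q'(1) skip push match by (auto split: if_splits)
  next
    case (Join a b c)
    then show ?thesis using assms(1,2) q'(1) skip push match by (auto split: if_splits)
  next
    case (Star a b c)
    then show ?thesis using assms(1,2) q'(1) skip push match by (auto split: if_splits)
  qed
qed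

lemma ex_cands_echo_gain:
  assumes "card A = 3"
  shows "proper A s \<Longrightarrow> set w \<subseteq> A \<Longrightarrow> \<exists>(q, d) \<in> cands s. echo q w (gain s w + d)"
proof (induction w arbitrary: s)
  case Nil
  have "([], 0) \<in> cands s" by (cases s) auto
  with echo_Nil show ?case by fastforce
next
  case (Cons x w)
  then have "x \<in> A" by simp
  with Cons proper_step[OF assms] obtain q' d' where
    "(q', d') \<in> cands (snd (step s x))" "echo q' w (gain (snd (step s x)) w + d')"
    by fastforce
  from ex_cands_echo_Cons[OF Cons.prems(1) \<open>x \<in> A\<close> this] show ?case by simp
qed

lemma gain_le_max_twins:
  assumes "card A = 3" "set w \<subseteq> A"
  shows "gain Empty w \<le> max_twins w"
proof -
  \<comment> \<open>\<open>Empty\<close> has the sole candidate \<open>[]\<close>, with deficit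
    0.\<close>
  have "echo [] w (gain Empty w)"
    using ex_cands_echo_gain[OF assms(1) _ assms(2), of Empty] by simp
  then show ?thesis unfolding max_twins_def
    by (intro Max_ge finite_has_twins) (simp add: echo_imp_has_twins)
qed

section \<open>Exponential moment of the gain\<close>

text \<open>The weights approximate the Perron eigenvector of the matrix of the chain with each gain \<open>g\<close>
  weighted by \<open>base ^ g\<close>, and \<open>rate\<close> slightly exceeds its eigenvalue divided by 3. The base must be
  close to 1 for \<open>log base rate\<close> to stay above \<open>0.411\<close>.\<close>

definition base :: real where "base = 97 / 100"

definition rate :: real where "rate = 987555 / 1000000"

fun weight :: "'a state \<Rightarrow> real" where
  "weight Empty = 1.02986"
| "weight (One a) = 1.01703"
| "weight (Fork a b) = 1.01127"
| "weight (Chain a b) = 1.00707"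
| "weight (Late a b) = 1.02791"
| "weight (Late2 a b c) = 1.02597"
| "weight (Join a b c) = 1.00189"
| "weight (Star a b c) = 1"

lemma weight_step:
  assumes "card A = 3" "proper A s"
  shows "(\<Sum>x\<in>A. base ^ fst (step s x) * weight (snd (step s x))) \<le> 3 * rate * weight s"
proof -
  \<comment> \<open>Naming the letters absent from the state turns the sum over \<open>A\<close>
    into three numerical terms.\<close>
  have ex1: "\<exists>b c. A = {a, b, c} \<and> distinct [a, b, c]" if "a \<in> A" for a
    using assms(1) that by (auto simp: card_3_iff)
  have ex2: "\<exists>c. A = {a, b, c} \<and> distinct [a, b, c]" if "a \<in> A" "b \<in> A" "a \<noteq> b" for a b
    using ex1[OF that(1)] that(2,3) by auto
  show ?thesis
  proof (cases s)
    case Empty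
    then show ?thesis using assms(1) by (simp add: base_def rate_def)
  next
    case (One a)
    then obtain b c where "A = {a, b, c}" "distinct [a, b, c]" using ex1[of a] assms(2) by auto
    with One show ?thesis by (simp add: base_def rate_def)
  next
    case (Fork a b)
    then obtain c where "A = {a, b, c}" "distinct [a, b, c]" using ex2[of a b] assms(2) by auto
    with Fork show ?thesis by (simp add: base_def rate_def)
  next
    case (Chain a b)
    then obtain c where "A = {a, b, c}" "distinct [a, b, c]" using ex2[of a b] assms(2) by auto
    with Chain show ?thesis by (simp add: base_def rate_def)
  next
    case (Late a b)
    then obtain c where "A = {a, b, c}" "distinct [a, b, c]" using ex2[of a b] assms(2) by auto
    with Late show ?thesis by (simp add: base_def rate_def)
  next
    case (Late2 a b c)
    then have "A = {a, b, c}" "distinct [a, b, c]" using assms(2) by simp_all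
    with Late2 show ?thesis by (simp add: base_def rate_def)
  next
    case (Join a b c)
    then have "A = {a, b, c}" "distinct [a, b, c]" using assms(2) by simp_all
    with Join show ?thesis by (simp add: base_def rate_def)
  next
    case (Star a b c)
    then have "A = {a, b, c}" "distinct [a, b, c]" using assms(2) by simp_all
    with Star show ?thesis by (simp add: base_def rate_def)
  qed
qed

lemma sum_lists_Suc:
  fixes f :: "'a list \<Rightarrow> 'b :: comm_monoid_add"
  shows "(\<Sum>w | set w \<subseteq> A \<and> length w = Suc n. f w) =
    (\<Sum>x\<in>A. \<Sum>w | set w \<subseteq> A \<and> length w = n. f (x # w))"
proof -
  have "(\<Sum>w | set w \<subseteq> A \<and> length w = Suc n. f w) =
    (\<Sum>(x, w) \<in> A \<times> {w. set w \<subseteq> A \<and> length w = n}. f (x # w))"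
    by (rule sum.reindex_bij_witness[where i = "\<lambda>(x, w). x # w" and j = "\<lambda>w. (hd w, tl w)"])
      (auto simp: length_Suc_conv)
  then show ?thesis by (simp add: sum.cartesian_product)
qed

text \<open>Splitting off the first letter, \<open>weight_step\<close> yields one factor
  \<open>3 * rate\<close> per letter.\<close>

lemma sum_power_gain_le:
  assumes "card A = 3"
  shows "proper A s \<Longrightarrow>
    (\<Sum>w | set w \<subseteq> A \<and> length w = n. base ^ gain s w) \<le> (3 * rate) ^ n * weight s"
proof (induction n arbitrary: s)
  case 0
  \<comment> \<open>The empty word contributes 1, so all weights must be at least 1;
    \<open>Star\<close> attains this.\<close>
  have "{w. set w \<subseteq> A \<and> length w = 0} = {[]}" by auto
  then show ?case by (cases s) auto
next
  case (Suc n)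
  have "(\<Sum>w | set w \<subseteq> A \<and> length w = Suc n. base ^ gain s w) =
    (\<Sum>x\<in>A. base ^ fst (step s x) *
      (\<Sum>w | set w \<subseteq> A \<and> length w = n. base ^ gain (snd (step s x)) w :: real))"
    by (simp add: sum_lists_Suc power_add sum_distrib_left)
  also have "\<dots> \<le> (\<Sum>x\<in>A. base ^ fst (step s x) *
      ((3 * rate) ^ n * weight (snd (step s x))))"
    using Suc proper_step[OF assms] by (intro sum_mono mult_left_mono) (auto simp: base_def)
  also have "\<dots> = (3 * rate) ^ n * (\<Sum>x\<in>A. base ^ fst (step s x) * weight (snd (step s x)))"
    by (simp add: sum_distrib_left mult.left_commute)
  also have "\<dots> \<le> (3 * rate) ^ n * (3 * rate * weight s)"
    using weight_step[OF assms Suc.prems] by (intro mult_left_mono) (auto simp: rate_def)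
  finally show ?case by (simp add: mult_ac)
qed

section \<open>Tail bound\<close>

lemma prob_max_twins_less:
  assumes "card A = 3"
  shows "measure_pmf.prob (random_word A n) {w. real (max_twins w) < \<tau> * real n}
    \<le> weight (Empty :: 'a state) * (rate / base powr \<tau>) ^ n"
    (is "measure_pmf.prob _ ?B \<le> _")
proof -
  define W where "W = {w. set w \<subseteq> A \<and> length w = n}"
  have fA: "finite A" using assms by (intro card_ge_0_finite) auto
  have fW: "finite W" unfolding W_def using finite_lists_length_eq[OF fA] .
  have cW: "card W = 3 ^ n" unfolding W_def using card_lists_length_eq[OF fA] assms by simp
  then have W: "W \<noteq> {}" by auto
  \<comment> \<open>Markov's inequality by counting: as \<open>base < 1\<close>, every bad word adds
    at least \<open>base powr (\<tau> * n)\<close> to the moment sum.\<close>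
  have "real (card (W \<inter> ?B)) * (base powr \<tau>) ^ n = (\<Sum>w\<in>W \<inter> ?B. base powr (\<tau> * n))"
    using base_def by (simp add: powr_powr[symmetric] powr_realpow)
  also have "\<dots> \<le> (\<Sum>w\<in>W \<inter> ?B. base ^ gain Empty w)"
  proof (rule sum_mono)
    fix w assume w: "w \<in> W \<inter> ?B"
    then have "gain Empty w \<le> max_twins w"
      using gain_le_max_twins[OF assms] by (simp add: W_def)
    with w have "real (gain Empty w) \<le> \<tau> * n" by simp
    then have "base powr (\<tau> * n) \<le> base powr gain Empty w"
      by (intro powr_mono') (auto simp: base_def)
    then show "base powr (\<tau> * n) \<le> base ^ gain Empty w" by (simp add: powr_realpow base_def)
  qed
  also have "\<dots> \<le> (\<Sum>w\<in>W. base ^ gain Empty w)"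
    using fW by (intro sum_mono2) (auto simp: base_def)
  also have "\<dots> \<le> (3 * rate) ^ n * weight (Empty :: 'a state)"
    unfolding W_def using sum_power_gain_le[OF assms, of Empty n] by simp
  finally have "real (card (W \<inter> ?B)) / 3 ^ n
      \<le> weight (Empty :: 'a state) * (rate / base powr \<tau>) ^ n"
    using base_def by (simp add: field_simps power_mult_distrib power_divide del: weight.simps)
  then show ?thesis
    unfolding random_word_def W_def[symmetric] by (simp add: measure_pmf_of_set[OF W fW] cW)
qed

lemma rate_less_base_powr: "rate < base powr 0.411"
proof -
  have "rate ^ 9 \<le> 893416 / 1000000"
    \<comment> \<open>Comparing \<open>rate ^ 90\<close> with \<open>base ^ 37\<close> through a rounded \<open>rate ^ 9\<close> keeps the integers short.\<close>
    unfolding rate_def by (simp add: power_divide)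
  then have "(rate ^ 9) ^ 10 \<le> (893416 / 1000000) ^ 10"
    by (rule power_mono) (simp add: rate_def)
  also have "\<dots> < base ^ 37"
    unfolding base_def by (simp add: power_divide)
  \<comment> \<open>37/90 is slightly above 0.411, and as \<open>base < 1\<close> the larger
    exponent gives the smaller power.\<close>
  also have "\<dots> = (base powr (37 / 90)) ^ 90"
    by (simp add: powr_power base_def)
  finally have "rate ^ 90 < (base powr (37 / 90)) ^ 90"
    by (simp flip: power_mult)
  then have "rate < base powr (37 / 90)"
    by (rule power_less_imp_less_base) simp
  also have "\<dots> \<le> base powr 0.411"
    by (intro powr_mono') (auto simp: base_def)
  finally show ?thesis .
qed

theorem theorem1p1:
  fixes A :: "'a set"
  assumes "card A = 3"
  shows "\<exists>c::real. c > 0 \<and> (\<forall>\<^sub>F n in sequentially.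
    measure_pmf.prob (random_word A n) {w. real (max_twins w) \<ge> 0.411 * real n}
      \<ge> 1 - exp (- (c * (real n / ln (real n)))))"
proof -
  define \<beta> :: real where "\<beta> = rate / base powr 0.411"
  define \<delta> where "\<delta> = - ln \<beta>"
  have \<beta>: "0 < \<beta>" "\<beta> < 1" using rate_less_base_powr by (auto simp: \<beta>_def rate_def base_def)
  then have \<delta>: "\<delta> > 0" by (simp add: \<delta>_def)
  \<comment> \<open>The factor 1.02986, the weight of \<open>Empty\<close>, is absorbed since n - n
    / ln n tends to infinity, so \<open>\<delta>\<close> itself serves as \<open>c\<close>.\<close>
  have "\<forall>\<^sub>F n in sequentially. ln 1.02986 + \<delta> * (real n / ln (real n)) \<le> \<delta> * real n"
    using \<delta> by real_asymp
  then have "\<forall>\<^sub>F n in sequentially.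
    measure_pmf.prob (random_word A n) {w. real (max_twins w) \<ge> 0.411 * real n}
      \<ge> 1 - exp (- (\<delta> * (real n / ln (real n))))"
  proof eventually_elim
    case (elim n)
    let ?P = "measure_pmf.prob (random_word A n)"
    have "1 - ?P {w. real (max_twins w) \<ge> 0.411 * real n} =
        ?P (- {w. real (max_twins w) \<ge> 0.411 * real n})"
      using measure_pmf.prob_compl[of "{w. real (max_twins w) \<ge> 0.411 * real n}" "random_word A n"]
      by (simp add: Compl_eq_Diff_UNIV)
    also have "- {w :: 'a list. real (max_twins w) \<ge> 0.411 * real n} =
        {w. real (max_twins w) < 0.411 * real n}"
      by auto
    also have "?P \<dots> \<le> 1.02986 * \<beta> ^ n"
      using prob_max_twins_less[OF assms, of n "0.411"] by (simp add: \<beta>_def)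
    also have "\<dots> = exp (ln 1.02986 - \<delta> * n)"
      using \<beta>(1) by (simp add: \<delta>_def exp_add exp_of_nat2_mult)
    also have "\<dots> \<le> exp (- (\<delta> * (real n / ln (real n))))"
      using elim by simp
    finally show ?case by simp
  qed
  with \<delta> show ?thesis by blast
qed

end
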